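(* Let $\nu$ be a complex parameter, and set $$\omega(s)=\frac{ds}{\sqrt{s(s-1)(s-\nu^2)}},\qquad \omega(t)=\frac{dt}{\sqrt{t(t-1)\bigl(t-(\frac{\nu+1}{\nu-1})^2\bigr)}},\qquad \omega=\omega(s)\wedge\omega(t).$$ Then one has the following inhomogeneous Picard-Fuchs equation of 2-forms: $$\frac{\partial^3\omega}{\partial\nu^3}+3\,\frac{2\nu+1}{\nu(\nu+1)}\frac{\partial^2\omega}{\partial\nu^2}+\frac{7\nu^4-6\nu^3-4\nu^2+6\nu+1}{(\nu-1)^2(\nu+1)^2\nu^2}\frac{\partial\omega}{\partial\nu}+\frac{\nu^4-2\nu^3-2\nu-1}{(\nu-1)^3(\nu+1)^2\nu^2}\,\omega=d_{\rm rel}\beta,$$ where $$\beta=-2\,\frac{s(s-1)(2\nu^4+3\nu^3-\nu^2-3\nu s+s\nu^2-2s)}{\nu(s-\nu^2)^2(\nu^2-1)^2\sqrt{s(s-1)(s-\nu^2)}}\,\omega(t)+\frac{6}{1-\nu^2}\,\frac{\sqrt{s(s-1)(s-\nu^2)}}{(s-\nu^2)^2}\,\omega'(t)$$ $$\qquad+\,2\,\frac{t(t-1)(2t\nu^4-7t\nu^3+7t\nu^2-t\nu-t-2\nu^4-7\nu^3-7\nu^2-\nu+1)}{\nu^2(\nu-1)^4\bigl(t-(\frac{\nu+1}{\nu-1})^2\bigr)^2(\nu^2-1)\sqrt{t(t-1)\bigl(t-(\frac{\nu+1}{\nu-1})^2\bigr)}}\,\omega(s)+6\,\frac{\sqrt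{t(t-1)\bigl(t-(\frac{\nu+1}{\nu-1})^2\bigr)}}{\nu(\nu-1)^2\bigl(t-(\frac{\nu+1}{\nu-1})^2\bigr)^2}\,\omega'(s).$$
   Context: The variables $s,t$ are regarded as flat coordinates, i.e. independent of $\nu$. Thus $\partial/\partial\nu$ of a differential form means differentiating its coefficient functions with respect to $\nu$ with $s,t$ fixed, and $\omega'(s)=\frac{\partial}{\partial\nu}\omega(s)$, $\omega'(t)=\frac{\partial}{\partial\nu}\omega(t)$. The operator $d_{\rm rel}$ is the relative exterior derivative, i.e. the exterior derivative in the variables $s,t$ only with $\nu$ constant. The same branches of the square roots are used consistently throughout. The parameter satisfies $\nu\neq 0,\pm1$ so that all expressions are defined. The form $\omega$ is the holomorphic 2-form on the Kummer surface with equation $u^2=s(s-1)(s-\nu^2)\,t(t-1)\bigl(t-(\frac{\nu+1}{\nu-1})^2\bigr)$. *)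

theory Defs
  imports "HOL-Analysis.Analysis"
begin

text \<open>
  Differential forms in the two coordinates (s, t), with the holomorphic tangent space at every
  point identified with pairs of complex numbers: a 1-form sends a point and a tangent vector to a
  number, a 2-form sends a point and two tangent vectors to a number.
  The parameter \<open>\<nu>\<close> is not one of the coordinates: objects depending on it are families of forms.
\<close>

type_synonym form1 = "complex \<times> complex \<Rightarrow> complex \<times> complex \<Rightarrow> complex"
type_synonym form2 = "complex \<times> complex \<Rightarrow> complex \<times> complex \<Rightarrow> complex \<times> complex \<Rightarrow> complex"

definition ds :: form1 where
  "ds p u = fst u"

definition dt :: form1 where
  "dt p u = snd u"

definition wedge :: "form1 \<Rightarrow> form1 \<Rightarrow> form2" where
  "wedge \<alpha> \<beta> p u v = \<alpha> p u * \<beta> p v - \<alpha> p v * \<beta> p u"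

text \<open>
  Exterior derivative in (s, t), evaluated on constant vector fields (so that the Lie bracket term
  is absent); it is applied to \<open>\<beta> \<nu>\<close> with \<open>\<nu>\<close> fixed, which makes it relative.
\<close>

definition d_rel :: "form1 \<Rightarrow> form2" where
  "d_rel \<alpha> p u v =
     frechet_derivative (\<lambda>q. \<alpha> q v) (at p) u - frechet_derivative (\<lambda>q. \<alpha> q u) (at p) v"

text \<open>
  Differentiation with respect to the parameter, at fixed s, t. The value of a form on constant
  vectors is a constant linear combination of its coefficient functions, so this differentiates
  the coefficients.
\<close>

definition d_nu1 :: "(complex \<Rightarrow> form1) \<Rightarrow> complex \<Rightarrow> form1" where
  "d_nu1 \<alpha> \<nu> p u = deriv (\<lambda>n. \<alpha> n p u) \<nu>"

definition d_nu2 :: "(complex \<Rightarrow> form2) \<Rightarrow> complex \<Rightarrow> form2" where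
  "d_nu2 \<alpha> \<nu> p u v = deriv (\<lambda>n. \<alpha> n p u v) \<nu>"

definition cubic_s :: "complex \<Rightarrow> complex \<Rightarrow> complex" where
  "cubic_s \<nu> s = s * (s - 1) * (s - \<nu>^2)"

definition tau :: "complex \<Rightarrow> complex" where
  "tau \<nu> = ((\<nu> + 1) / (\<nu> - 1))^2"

definition cubic_t :: "complex \<Rightarrow> complex \<Rightarrow> complex" where
  "cubic_t \<nu> t = t * (t - 1) * (t - tau \<nu>)"

text \<open>
  A branch of the square root of a function of two variables, on an open set of arguments on which
  it varies continuously in both of them jointly.
\<close>

definition sqrt_branch_on ::
  "(complex \<times> complex) set \<Rightarrow> (complex \<Rightarrow> complex \<Rightarrow> complex) \<Rightarrow> (complex \<Rightarrow> complex \<Rightarrow> complex) \<Rightarrow> bool"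
where
  "sqrt_branch_on U f r \<longleftrightarrow>
     open U \<and> continuous_on U (\<lambda>(x, y). r x y) \<and> (\<forall>(x, y) \<in> U. (r x y)^2 = f x y)"

text \<open>
  In the following, \<open>rs\<close> and \<open>rt\<close> are the chosen branches of the square roots of \<open>cubic_s\<close> and
  \<open>cubic_t\<close>.
\<close>

definition omega_s :: "(complex \<Rightarrow> complex \<Rightarrow> complex) \<Rightarrow> complex \<Rightarrow> form1" where
  "omega_s rs \<nu> = (\<lambda>(s, t) u. 1 / rs \<nu> s * ds (s, t) u)"

definition omega_t :: "(complex \<Rightarrow> complex \<Rightarrow> complex) \<Rightarrow> complex \<Rightarrow> form1" where
  "omega_t rt \<nu> = (\<lambda>(s, t) u. 1 / rt \<nu> t * dt (s, t) u)"

definition omega ::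
  "(complex \<Rightarrow> complex \<Rightarrow> complex) \<Rightarrow> (complex \<Rightarrow> complex \<Rightarrow> complex) \<Rightarrow> complex \<Rightarrow> form2"
where
  "omega rs rt \<nu> = wedge (omega_s rs \<nu>) (omega_t rt \<nu>)"

definition beta ::
  "(complex \<Rightarrow> complex \<Rightarrow> complex) \<Rightarrow> (complex \<Rightarrow> complex \<Rightarrow> complex) \<Rightarrow> complex \<Rightarrow> form1"
where
  "beta rs rt \<nu> = (\<lambda>(s, t) u.
     - 2 * (s * (s - 1) * (2 * \<nu>^4 + 3 * \<nu>^3 - \<nu>^2 - 3 * \<nu> * s + s * \<nu>^2 - 2 * s)
            / (\<nu> * (s - \<nu>^2)^2 * (\<nu>^2 - 1)^2 * rs \<nu> s))
         * omega_t rt \<nu> (s, t) u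
     + 6 / (1 - \<nu>^2) * (rs \<nu> s / (s - \<nu>^2)^2)
         * d_nu1 (omega_t rt) \<nu> (s, t) u
     + 2 * (t * (t - 1) * (2 * t * \<nu>^4 - 7 * t * \<nu>^3 + 7 * t * \<nu>^2 - t * \<nu> - t
                           - 2 * \<nu>^4 - 7 * \<nu>^3 - 7 * \<nu>^2 - \<nu> + 1)
            / (\<nu>^2 * (\<nu> - 1)^4 * (t - tau \<nu>)^2 * (\<nu>^2 - 1) * rt \<nu> t))
         * omega_s rs \<nu> (s, t) u
     + 6 * (rt \<nu> t / (\<nu> * (\<nu> - 1)^2 * (t - tau \<nu>)^2))
         * d_nu1 (omega_s rs) \<nu> (s, t) u)"

end

theory Submission
  imports Defs
begin

section \<open>Branches of square roots\<close>

text \<open>A branch is only known to be continuous; its derivatives in both variables come from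
  \<open>r^2\<close> alone. The obstacle is the coupling of the two variables. Write
  \<open>l_i\<close>, \<open>m_j\<close> for the factors \<open>L1\<close>, \<open>L2\<close>,
  \<open>L3\<close> of the s-curve and of the t-curve. By the Leibniz rule the left side divided by
  \<open>omega\<close> is a combination of products \<open>l_i m_j\<close> with i + j <= 3, so one
  index is always at most 1. This is why \<open>beta\<close> needs each factor of
  \<open>omega\<close> only itself and once differentiated: \<open>d_rel beta\<close> divided by
  \<open>omega\<close> has the shape \<open>p + q m_1 + r + l_1 z\<close> with p, q depending on s
  and r, z on t. The splitting is not unique, since each of 1, \<open>l_1\<close>,
  \<open>m_1\<close>, \<open>l_1 m_1\<close> fits into two of the four groups. Four constants,
  \<open>k1\<close> to \<open>k4\<close> in the final proof, fix how these terms are shared. Each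
  group is then the derivative of a function on a single curve.\<close>

lemma DERIV_sqrt_branch:
  fixes f g :: "complex \<Rightarrow> complex"
  assumes cont: "isCont g x" and sq: "\<forall>\<^sub>F z in nhds x. (g z)^2 = f z"
    and f: "(f has_field_derivative D) (at x)" and nz: "g x \<noteq> 0"
  shows "(g has_field_derivative D / (2 * g x)) (at x)"
proof -
  have sqx: "(g x)^2 = f x"
    using sq by (rule eventually_nhds_x_imp_x)
  \<comment> \<open>The difference quotient of \<open>g\<close> is that of \<open>f = g^2\<close>
    divided by \<open>g z + g x\<close>, whose limit \<open>2 * g x\<close> is nonzero. Continuity
    of \<open>g\<close> is thus enough.\<close>
  have sum: "((\<lambda>z. g z + g x) \<longlongrightarrow> g x + g x) (at x)"
    by (rule tendsto_add[OF cont[unfolded isCont_def] tendsto_const])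
  have nz2: "g x + g x \<noteq> 0"
    using nz by (simp flip: mult_2)
  have lim: "((\<lambda>z. (f z - f x) / (z - x) / (g z + g x)) \<longlongrightarrow> D / (g x + g x)) (at x)"
    by (rule tendsto_divide[OF f[unfolded has_field_derivative_iff] sum nz2])
  have "\<forall>\<^sub>F z in at x. g z + g x \<noteq> 0"
    by (rule tendsto_imp_eventually_ne[OF sum nz2])
  moreover have "\<forall>\<^sub>F z in at x. (g z)^2 = f z"
    using sq by (simp add: eventually_nhds_conv_at)
  ultimately have "\<forall>\<^sub>F z in at x. (f z - f x) / (z - x) / (g z + g x) = (g z - g x) / (z - x)"
  proof eventually_elim
    case (elim z)
    have "(g z)^2 - (g x)^2 = (g z - g x) * (g z + g x)"
      by (simp add: power2_eq_square algebra_simps)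
    then have "f z - f x = (g z - g x) * (g z + g x)"
      by (simp only: elim(2) sqx)
    then show ?case
      using elim(1) by simp
  qed
  then have "((\<lambda>z. (g z - g x) / (z - x)) \<longlongrightarrow> D / (g x + g x)) (at x)"
    using lim by (rule Lim_transform_eventually[rotated])
  then show ?thesis
    by (simp only: has_field_derivative_iff mult_2)
qed

text \<open>The logarithmic derivative of \<open>1 / g\<close> is expressed by \<open>f\<close> and
  \<open>D\<close> alone, so the branch enters only through the factor \<open>1 / g\<close>. This
  shape survives repeated differentiation.\<close>

lemma DERIV_inverse_sqrt_branch:
  fixes f g :: "complex \<Rightarrow> complex"
  assumes "isCont g x" and sq: "\<forall>\<^sub>F z in nhds x. (g z)^2 = f z"
    and "(f has_field_derivative D) (at x)" and nz: "g x \<noteq> 0"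
  shows "((\<lambda>z. 1 / g z) has_field_derivative - D / (2 * f x) * (1 / g x)) (at x)"
proof -
  have sqx: "f x = (g x)^2"
    using eventually_nhds_x_imp_x[OF sq] by (rule sym)
  have "((\<lambda>z. 1 / g z) has_field_derivative (0 * g x - 1 * (D / (2 * g x))) / (g x * g x)) (at x)"
    by (rule DERIV_divide[OF DERIV_const DERIV_sqrt_branch[OF assms] nz])
  then show ?thesis
    unfolding sqx by (rule DERIV_cong) (use nz in \<open>simp add: divide_simps power2_eq_square\<close>)
qed

text \<open>
  Both curves have the shape \<open>r^2 = e (e - 1) (e - h n)\<close>. With \<open>W = 1 / r\<close>, \<open>y = 1 / (e - h n)\<close>
  and \<open>h' = 2 m\<close> one gets \<open>W' = m y W\<close> and \<open>y' = 2 m y^2\<close>, so all parameter derivatives of \<open>W\<close>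
  are \<open>W\<close> times polynomials in \<open>y\<close>.
\<close>

locale legendre_branch =
  fixes U :: "(complex \<times> complex) set" and h m m1 m2 :: "complex \<Rightarrow> complex"
    and X :: "complex set" and r :: "complex \<Rightarrow> complex \<Rightarrow> complex"
  assumes branch: "sqrt_branch_on U (\<lambda>n e. e * (e - 1) * (e - h n)) r"
    and open_X: "open X"
    and h: "n \<in> X \<Longrightarrow> (h has_field_derivative 2 * m n) (at n)"
    and m: "n \<in> X \<Longrightarrow> (m has_field_derivative m1 n) (at n)"
    and m1: "n \<in> X \<Longrightarrow> (m1 has_field_derivative m2 n) (at n)"
begin

text \<open>Slices of \<open>U\<close> without the branch points, one for each variable held fixed.
  They are open, so an equation that holds on a slice can be differentiated there.\<close>

definition "pdom e = {n \<in> X. (n, e) \<in> U \<and> e \<notin> {0, 1, h n}}"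
definition "cdom n = {e. (n, e) \<in> U \<and> e \<notin> {0, 1, h n}}"
definition "y n e = 1 / (e - h n)"
definition "W n e = 1 / r n e"
text \<open>From \<open>W' = L1 W\<close> one gets the recursion
  \<open>L(k+1) = Lk' + L1 Lk\<close>, and \<open>y' = 2 m y^2\<close> turns it into these
  polynomials.\<close>

definition "L1 n e = m n * y n e"
definition "L2 n e = m1 n * y n e + 3 * (m n)^2 * (y n e)^2"
definition "L3 n e = m2 n * y n e + 9 * m n * m1 n * (y n e)^2 + 15 * (m n)^3 * (y n e)^3"

lemma open_U: "open U" and cont: "continuous_on U (\<lambda>(n, e). r n e)"
  and sq: "(n, e) \<in> U \<Longrightarrow> (r n e)^2 = e * (e - 1) * (e - h n)"
  using branch by (auto simp: sqrt_branch_on_def)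

lemma open_cdom: "open (cdom n)"
proof -
  have "cdom n = ((\<lambda>e. (n, e)) -` U) \<inter> - {0, 1, h n}"
    by (auto simp: cdom_def)
  moreover have "open ((\<lambda>e. (n, e)) -` U)"
    using open_U by (intro open_vimage continuous_intros)
  ultimately show ?thesis
    by (metis open_Int open_Compl finite_imp_closed finite.emptyI finite.insertI)
qed

lemma open_pdom: "open (pdom e)"
proof -
  \<comment> \<open>With \<open>e\<close> fixed, the only branch-point condition that involves
    \<open>n\<close> is \<open>e \<noteq> h n\<close>, and continuity of \<open>h\<close> makes it
    open.\<close>
  have "pdom e = (if e \<in> {0, 1} then {} else
      ((\<lambda>n. (n, e)) -` U) \<inter> (X \<inter> h -` (- {e})))"
    by (auto simp: pdom_def)
  moreover have "open ((\<lambda>n. (n, e)) -` U)"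
    using open_U by (intro open_vimage continuous_intros)
  moreover have "continuous_on X h"
    using h by (auto intro!: continuous_at_imp_continuous_on DERIV_isCont)
  then have "open (X \<inter> h -` (- {e}))"
    using open_X by (intro continuous_open_preimage) auto
  ultimately show ?thesis
    by auto
qed

lemma isCont_param: "(n, e) \<in> U \<Longrightarrow> isCont (\<lambda>n. r n e) n"
  and isCont_coord: "(n, e) \<in> U \<Longrightarrow> isCont (\<lambda>e. r n e) e"
proof -
  assume "(n, e) \<in> U"
  then have c: "isCont (\<lambda>(n, e). r n e) (n, e)"
    using cont open_U by (simp add: continuous_on_eq_continuous_at)
  show "isCont (\<lambda>n. r n e) n"
    using isCont_o2[of n "\<lambda>n. (n, e)" "\<lambda>(n, e). r n e"] c by simp
  show "isCont (\<lambda>e. r n e) e"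
    using isCont_o2[of e "\<lambda>e. (n, e)" "\<lambda>(n, e). r n e"] c by simp
qed

lemma r_nonzero: "(n, e) \<in> U \<Longrightarrow> e \<notin> {0, 1, h n} \<Longrightarrow> r n e \<noteq> 0"
  using sq[of n e] by auto

section \<open>Derivatives in the parameter, at a fixed coordinate\<close>

lemma DERIV_y:
  assumes "n \<in> pdom e"
  shows "((\<lambda>n. y n e) has_field_derivative 2 * m n * (y n e)^2) (at n)"
proof -
  have "((\<lambda>n. 1 / (e - h n)) has_field_derivative
      (0 * (e - h n) - 1 * (0 - 2 * m n)) / ((e - h n) * (e - h n))) (at n)"
    using assms by (intro DERIV_divide DERIV_diff DERIV_const h) (auto simp: pdom_def)
  then show ?thesis
    unfolding y_def by (rule DERIV_cong) (simp add: power2_eq_square)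
qed

text \<open>Only the factor \<open>e - h n\<close> of the cubic depends on the parameter. Its
  logarithmic derivative is \<open>-2 m y\<close>, and \<open>W\<close> receives -1/2 of it.\<close>

lemma DERIV_W:
  assumes "n \<in> pdom e"
  shows "((\<lambda>n. W n e) has_field_derivative L1 n e * W n e) (at n)"
proof -
  have U: "n \<in> X" "(n, e) \<in> U" "e \<notin> {0, 1, h n}"
    using assms by (auto simp: pdom_def)
  have "\<forall>\<^sub>F z in nhds n. (r z e)^2 = e * (e - 1) * (e - h z)"
    using eventually_nhds_in_open[OF open_pdom assms] by eventually_elim (auto simp: pdom_def sq)
  moreover have "((\<lambda>z. e * (e - 1) * (e - h z)) has_field_derivative
      - (2 * m n) * (e * (e - 1))) (at n)"
    using h U by (auto intro!: derivative_eq_intros simp: algebra_simps)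
  ultimately have "((\<lambda>n. W n e) has_field_derivative
     - (- (2 * m n) * (e * (e - 1))) / (2 * (e * (e - 1) * (e - h n))) * W n e) (at n)"
    unfolding W_def using U r_nonzero isCont_param by (intro DERIV_inverse_sqrt_branch) auto
  moreover have "- (- (2 * m n) * (e * (e - 1))) / (2 * (e * (e - 1) * (e - h n))) = L1 n e"
    using U by (simp add: L1_def y_def divide_simps)
  ultimately show ?thesis
    by simp
qed

lemma DERIV_W1:
  assumes "n \<in> pdom e"
  shows "((\<lambda>n. L1 n e * W n e) has_field_derivative L2 n e * W n e) (at n)"
proof -
  have X: "n \<in> X"
    using assms by (simp add: pdom_def)
  show ?thesis
    unfolding L1_def
    by (rule DERIV_cong,
        (rule DERIV_W[OF assms] DERIV_y[OF assms] m[OF X] DERIV_mult)+)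
      (simp add: L1_def L2_def, algebra)
qed

lemma DERIV_W2:
  assumes "n \<in> pdom e"
  shows "((\<lambda>n. L2 n e * W n e) has_field_derivative L3 n e * W n e) (at n)"
proof -
  have X: "n \<in> X"
    using assms by (simp add: pdom_def)
  show ?thesis
    unfolding L2_def
    by (rule DERIV_cong,
        (rule DERIV_W[OF assms] DERIV_y[OF assms] m[OF X] m1[OF X]
          DERIV_const DERIV_power DERIV_mult DERIV_add)+)
      (simp add: L1_def L3_def, algebra)
qed

section \<open>Derivatives in the coordinate, at a fixed parameter\<close>

lemma DERIV_W_coord:
  assumes "e \<in> cdom n"
  shows "((\<lambda>e. W n e) has_field_derivative - (1 / e + 1 / (e - 1) + y n e) / 2 * W n e) (at e)"
proof -
  have U: "(n, e) \<in> U" "e \<notin> {0, 1, h n}"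
    using assms by (auto simp: cdom_def)
  have "\<forall>\<^sub>F z in nhds e. (r n z)^2 = z * (z - 1) * (z - h n)"
    using eventually_nhds_in_open[OF open_cdom assms] by eventually_elim (auto simp: cdom_def sq)
  moreover have "((\<lambda>z. z * (z - 1) * (z - h n)) has_field_derivative
      ((e - 1) + e) * (e - h n) + e * (e - 1)) (at e)"
    by (auto intro!: derivative_eq_intros simp: algebra_simps)
  ultimately have "((\<lambda>e. W n e) has_field_derivative
     - (((e - 1) + e) * (e - h n) + e * (e - 1)) / (2 * (e * (e - 1) * (e - h n))) * W n e) (at e)"
    unfolding W_def using U r_nonzero isCont_coord by (intro DERIV_inverse_sqrt_branch) auto
  moreover have "- (((e - 1) + e) * (e - h n) + e * (e - 1)) / (2 * (e * (e - 1) * (e - h n)))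
      = - (1 / e + 1 / (e - 1) + y n e) / 2"
    using U by (simp add: y_def divide_simps)
  ultimately show ?thesis
    by (simp only:)
qed

lemma DERIV_y_coord:
  assumes "e \<in> cdom n"
  shows "((\<lambda>e. y n e) has_field_derivative - ((y n e)^2)) (at e)"
proof -
  have "((\<lambda>e. 1 / (e - h n)) has_field_derivative
      (0 * (e - h n) - 1 * (1 - 0)) / ((e - h n) * (e - h n))) (at e)"
    using assms by (intro DERIV_divide DERIV_diff DERIV_const DERIV_ident) (auto simp: cdom_def)
  then show ?thesis
    unfolding y_def by (rule DERIV_cong) (simp add: power2_eq_square)
qed

text \<open>
  By \<open>e = h n + 1 / y\<close> the next two derivatives can be written as polynomials in \<open>y\<close>.
\<close>

lemma DERIV_cubic_W:
  assumes "e \<in> cdom n"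
  shows "((\<lambda>e. e * (e - 1) * (a * e + b) / ((e - h n)^2 * r n e)) has_field_derivative
    (- a / 2 - (a * (2 * h n - 1) + 3 / 2 * (a * h n + b)) * y n e
        - (3 / 2 * a * (h n * (h n - 1)) + 2 * (a * h n + b) * (2 * h n - 1)) * (y n e)^2
        - 5 / 2 * (a * h n + b) * (h n * (h n - 1)) * (y n e)^3) * W n e) (at e)"
proof -
  have nz: "e \<noteq> 0" "e - 1 \<noteq> 0" and y: "(e - h n) * y n e = 1"
    using assms by (auto simp: cdom_def y_def)
  \<comment> \<open>This is an equality of functions on the whole plane: where a denominator
    vanishes, both sides are 0 by the convention for division.\<close>
  have "(\<lambda>e. e * (e - 1) * (a * e + b) / ((e - h n)^2 * r n e))
     = (\<lambda>e. e * (e - 1) * (a * e + b) * (y n e)^2 * W n e)"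
    by (simp add: y_def W_def power_divide fun_eq_iff)
  moreover have "((\<lambda>e. e * (e - 1) * (a * e + b) * (y n e)^2 * W n e) has_field_derivative
    (- a / 2 - (a * (2 * h n - 1) + 3 / 2 * (a * h n + b)) * y n e
        - (3 / 2 * a * (h n * (h n - 1)) + 2 * (a * h n + b) * (2 * h n - 1)) * (y n e)^2
        - 5 / 2 * (a * h n + b) * (h n * (h n - 1)) * (y n e)^3) * W n e) (at e)"
    by (rule DERIV_cong,
        (rule DERIV_W_coord[OF assms] DERIV_y_coord[OF assms]
          DERIV_const DERIV_ident DERIV_power DERIV_mult DERIV_add DERIV_diff)+)
      (use nz y in \<open>simp add: divide_simps, algebra\<close>)
  ultimately show ?thesis
    by simp
qed

lemma DERIV_r_quotient:
  assumes "e \<in> cdom n"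
  shows "((\<lambda>e. r n e / (e - h n)^2) has_field_derivative
    (- 1 / 2 - (2 * h n - 1) * y n e - 3 / 2 * (h n * (h n - 1)) * (y n e)^2) * W n e) (at e)"
proof -
  have nz: "e \<noteq> 0" "e - 1 \<noteq> 0" and y: "(e - h n) * y n e = 1"
    using assms by (auto simp: cdom_def y_def)
  \<comment> \<open>On \<open>cdom n\<close> one has \<open>r = r^2 W\<close> and
    \<open>r^2 y = e (e - 1)\<close>, hence \<open>r y^2 = e (e - 1) y W\<close>. The right side
    contains the branch only through \<open>W\<close>.\<close>
  have "((\<lambda>e. e * (e - 1) * y n e * W n e) has_field_derivative
    (- 1 / 2 - (2 * h n - 1) * y n e - 3 / 2 * (h n * (h n - 1)) * (y n e)^2) * W n e) (at e)"
    by (rule DERIV_cong,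
        (rule DERIV_W_coord[OF assms] DERIV_y_coord[OF assms]
          DERIV_const DERIV_ident DERIV_mult DERIV_diff)+)
      (use nz y in \<open>simp add: divide_simps, algebra\<close>)
  then show ?thesis
  proof (rule has_field_derivative_transform_within_open[OF _ open_cdom assms])
    fix z assume z: "z \<in> cdom n"
    then have "(r n z)^2 = z * (z - 1) * (z - h n)" "r n z \<noteq> 0" "z - h n \<noteq> 0"
      using sq r_nonzero by (auto simp: cdom_def)
    then show "z * (z - 1) * y n z * W n z = r n z / (z - h n)^2"
      by (simp add: y_def W_def divide_simps) algebra
  qed
qed

end


section \<open>The identity between rational functions\<close>

text \<open>
  After division by \<open>\<omega>\<close> both sides are polynomials in \<open>1 / (s - n^2)\<close> and \<open>1 / (t - tau n)\<close>.
  Comparing coefficients splits the equation into four equations in one of the two variables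
  each; the constants \<open>3 / (1 - n^2)\<close>, \<open>- 3 / (n (n - 1)^2)\<close> and
  \<open>(n^2 - 3 n - 2) / (n (n^2 - 1)^2)\<close> by which these are coupled are the limits at infinity.
\<close>

lemma mixed_identity_s:
  fixes n y :: complex
  assumes "n \<noteq> 0" "n \<noteq> 1" "n \<noteq> -1"
  shows "3 * (y + 3 * n^2 * y^2) + (3 - 9 * n^2) / (n * (1 - n^2)) * (n * y) - 3 / (1 - n^2)
    = 6 / (1 - n^2) * (- 1 / 2 - (2 * n^2 - 1) * y - 3 / 2 * (n^2 * (n^2 - 1)) * y^2)"
proof -
  have "1 - n^2 \<noteq> 0"
    using assms by (auto simp: power2_eq_1_iff)
  then show ?thesis
    using assms(1) by (simp add: divide_simps) algebra
qed

text \<open>The group multiplying the undifferentiated t-factor, with \<open>m = n\<close>,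
  \<open>m1 = 1\<close>, \<open>m2 = 0\<close> put into \<open>L1\<close>, \<open>L2\<close>,
  \<open>L3\<close>. The polynomial \<open>a * s + b\<close> is the last factor of the numerator in
  the first term of \<open>beta\<close>.\<close>

lemma pure_identity_s:
  fixes n y :: complex
  assumes "n \<noteq> 0" "n \<noteq> 1" "n \<noteq> -1"
  defines "a \<equiv> n^2 - 3 * n - 2" and "b \<equiv> 2 * n^4 + 3 * n^3 - n^2"
  shows "9 * n * y^2 + 15 * n^3 * y^3 + 3 * ((2 * n + 1) / (n * (n + 1))) * (y + 3 * n^2 * y^2)
     + ((7 * n^4 - 6 * n^3 - 4 * n^2 + 6 * n + 1) / ((n - 1)^2 * (n + 1)^2 * n^2)
          - 3 / (n * (n - 1)^2)) * (n * y)
     + (n^2 - 3 * n - 2) / (n * (n^2 - 1)^2)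
    = - 2 / (n * (n^2 - 1)^2) * (- a / 2 - (a * (2 * n^2 - 1) + 3 / 2 * (a * n^2 + b)) * y
        - (3 / 2 * a * (n^2 * (n^2 - 1)) + 2 * (a * n^2 + b) * (2 * n^2 - 1)) * y^2
        - 5 / 2 * (a * n^2 + b) * (n^2 * (n^2 - 1)) * y^3)"
    (is "?L = ?R")
proof -
  define c where "c = n * (n - 1)^2 * (n + 1)^2"
  have nz: "n + 1 \<noteq> 0" "n - 1 \<noteq> 0"
    using assms by (auto simp: eq_neg_iff_add_eq_0)
  then have c: "c \<noteq> 0"
    using assms(1) by (simp add: c_def)
  have d: "n * (n^2 - 1)^2 = c"
    unfolding c_def by algebra
  have "c * ?L = (9 * n * y^2 + 15 * n^3 * y^3) * c
     + 3 * (2 * n + 1) * ((n - 1)^2 * (n + 1)) * (y + 3 * n^2 * y^2)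
     + (7 * n^4 - 6 * n^3 - 4 * n^2 + 6 * n + 1 - 3 * n * (n + 1)^2) * y
     + (n^2 - 3 * n - 2)"
    unfolding d unfolding c_def using nz assms(1) by (simp add: divide_simps) algebra
  also have "\<dots> = - 2 * (- a / 2 - (a * (2 * n^2 - 1) + 3 / 2 * (a * n^2 + b)) * y
        - (3 / 2 * a * (n^2 * (n^2 - 1)) + 2 * (a * n^2 + b) * (2 * n^2 - 1)) * y^2
        - 5 / 2 * (a * n^2 + b) * (n^2 * (n^2 - 1)) * y^3)"
    unfolding a_def b_def c_def by (simp add: divide_simps) algebra
  also have "\<dots> = c * ?R"
    unfolding d using c by simp
  finally show ?thesis
    unfolding mult_cancel_left using c by simp
qed

text \<open>Half the derivative of \<open>tau\<close>, followed by its first two derivatives: these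
  are \<open>m\<close>, \<open>m1\<close>, \<open>m2\<close> for the t-curve.\<close>

definition mu :: "complex \<Rightarrow> complex" where
  "mu n = - 2 * (n + 1) / (n - 1)^3"

definition mu' :: "complex \<Rightarrow> complex" where
  "mu' n = (4 * n + 8) / (n - 1)^4"

definition mu'' :: "complex \<Rightarrow> complex" where
  "mu'' n = (- 12 * n - 36) / (n - 1)^5"

text \<open>
  The substitution \<open>y = (n - 1)^2 w\<close> clears the denominator of \<open>tau n\<close>.
\<close>

lemma mu_tau_scaled:
  fixes n w :: complex
  assumes "n \<noteq> 1"
  defines "y \<equiv> (n - 1)^2 * w"
  shows "mu n * y = - 2 * (n + 1) * w / (n - 1)"
    and "mu' n * y = (4 * n + 8) * w / (n - 1)^2"
    and "mu'' n * y = (- 12 * n - 36) * w / (n - 1)^3"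
    and "(2 * tau n - 1) * y = (n^2 + 6 * n + 1) * w"
    and "tau n * (tau n - 1) * y^2 = 4 * n * (n + 1)^2 * w^2"
    and "(a * tau n + b) * y = (a * (n + 1)^2 + b * (n - 1)^2) * w"
proof -
  have nz: "n - 1 \<noteq> 0"
    using assms by simp
  show "mu n * y = - 2 * (n + 1) * w / (n - 1)"
    "mu' n * y = (4 * n + 8) * w / (n - 1)^2"
    "mu'' n * y = (- 12 * n - 36) * w / (n - 1)^3"
    using nz unfolding mu_def mu'_def mu''_def y_def by (simp_all add: divide_simps) algebra+
  have tau: "tau n * (n - 1)^2 = (n + 1)^2"
    using nz by (simp add: tau_def power_divide)
  show "(2 * tau n - 1) * y = (n^2 + 6 * n + 1) * w"
    "tau n * (tau n - 1) * y^2 = 4 * n * (n + 1)^2 * w^2"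
    "(a * tau n + b) * y = (a * (n + 1)^2 + b * (n - 1)^2) * w"
    unfolding y_def using tau by algebra+
qed

text \<open>The group multiplying \<open>L1\<close> of the s-curve. The product of the two
  first-order factors has total coefficient \<open>6 (2 n + 1) / (n (n + 1))\<close>; the share
  \<open>(3 - 9 n^2) / (n (1 - n^2))\<close> already used in \<open>mixed_identity_s\<close> is
  subtracted.\<close>

lemma mixed_identity_t:
  fixes n y :: complex
  assumes "n \<noteq> 0" "n \<noteq> 1" "n \<noteq> -1"
  defines "h \<equiv> tau n"
  shows "3 * (mu' n * y + 3 * (mu n)^2 * y^2)
     + (6 * ((2 * n + 1) / (n * (n + 1))) - (3 - 9 * n^2) / (n * (1 - n^2))) * (mu n * y)
     + 3 / (n * (n - 1)^2)
    = - 6 / (n * (n - 1)^2) * (- 1 / 2 - (2 * h - 1) * y - 3 / 2 * (h * (h - 1)) * y^2)"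
    (is "?L = ?R")
proof -
  define w where "w = y / (n - 1)^2"
  define c where "c = n * (n - 1)^2"
  have nz: "n + 1 \<noteq> 0" "n - 1 \<noteq> 0"
    using assms by (auto simp: eq_neg_iff_add_eq_0)
  then have y: "y = (n - 1)^2 * w"
    by (simp add: w_def)
  have c: "c \<noteq> 0"
    using nz assms(1) by (simp add: c_def)
  note scaled = mu_tau_scaled[OF assms(2), where w = w, folded y h_def]
  have d: "1 - n^2 = - ((n - 1) * (n + 1))"
    by algebra
  have k: "6 * ((2 * n + 1) / (n * (n + 1))) - (3 - 9 * n^2) / (n * (1 - n^2))
      = 3 * (n^2 - 2 * n - 1) / (n * (n - 1) * (n + 1))"
    unfolding d using nz assms(1) by (simp add: divide_simps) algebra
  have "?L = 3 * (mu' n * y + 3 * (mu n * y)^2)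
     + 3 * (n^2 - 2 * n - 1) / (n * (n - 1) * (n + 1)) * (mu n * y) + 3 / (n * (n - 1)^2)"
    unfolding k by (simp add: power_mult_distrib)
  also have "c * \<dots> = 3 * n * ((4 * n + 8) * w + 12 * (n + 1)^2 * w^2)
      - 6 * (n^2 - 2 * n - 1) * w + 3"
    unfolding scaled c_def using nz assms(1) by (simp add: divide_simps) algebra
  also have "\<dots> = - 6 * (- 1 / 2 - (n^2 + 6 * n + 1) * w - 3 / 2 * (4 * n * (n + 1)^2 * w^2))"
    by (simp add: divide_simps) algebra
  also have "\<dots> = - 6 * (- 1 / 2 - (2 * h - 1) * y - 3 / 2 * (h * (h - 1)) * y^2)"
    unfolding scaled(4,5)[symmetric] by simp
  also have "\<dots> = c * ?R"
    unfolding c_def[symmetric] using c by simp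
  finally show ?thesis
    unfolding mult_cancel_left using c by simp
qed

text \<open>What is left after the other three groups: the terms free of s, corrected by the shares
  of the first-order and constant terms given to the s-curve.\<close>

lemma pure_identity_t:
  fixes n y :: complex
  assumes "n \<noteq> 0" "n \<noteq> 1" "n \<noteq> -1"
  defines "h \<equiv> tau n" and "a \<equiv> 2 * n^4 - 7 * n^3 + 7 * n^2 - n - 1"
    and "b \<equiv> - 2 * n^4 - 7 * n^3 - 7 * n^2 - n + 1"
  shows "mu'' n * y + 9 * mu n * mu' n * y^2 + 15 * (mu n)^3 * y^3
     + 3 * ((2 * n + 1) / (n * (n + 1))) * (mu' n * y + 3 * (mu n)^2 * y^2)
     + ((7 * n^4 - 6 * n^3 - 4 * n^2 + 6 * n + 1) / ((n - 1)^2 * (n + 1)^2 * n^2)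
          + 3 / (1 - n^2)) * (mu n * y)
     + (n^4 - 2 * n^3 - 2 * n - 1) / ((n - 1)^3 * (n + 1)^2 * n^2)
     - (n^2 - 3 * n - 2) / (n * (n^2 - 1)^2)
    = - 2 / (n^2 * (n - 1)^4 * (n^2 - 1))
        * (- a / 2 - (a * (2 * h - 1) + 3 / 2 * (a * h + b)) * y
           - (3 / 2 * a * (h * (h - 1)) + 2 * (a * h + b) * (2 * h - 1)) * y^2
           - 5 / 2 * (a * h + b) * (h * (h - 1)) * y^3)"
    (is "?L = ?R")
proof -
  define w where "w = y / (n - 1)^2"
  define c where "c = n^2 * (n - 1)^4 * (n^2 - 1)"
  have nz: "n + 1 \<noteq> 0" "n - 1 \<noteq> 0"
    using assms by (auto simp: eq_neg_iff_add_eq_0)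
  then have y: "y = (n - 1)^2 * w"
    by (simp add: w_def)
  have c': "c = n^2 * (n - 1)^5 * (n + 1)"
    unfolding c_def by algebra
  have c: "c \<noteq> 0"
    using nz assms(1) by (simp add: c')
  note scaled = mu_tau_scaled[OF assms(2), where w = w, folded y h_def]
  have d: "1 - n^2 = - ((n - 1) * (n + 1))" "n^2 - 1 = (n - 1) * (n + 1)"
    by algebra+
  have k1: "(7 * n^4 - 6 * n^3 - 4 * n^2 + 6 * n + 1) / ((n - 1)^2 * (n + 1)^2 * n^2) + 3 / (1 - n^2)
      = (4 * n^4 - 6 * n^3 - n^2 + 6 * n + 1) / ((n - 1)^2 * (n + 1)^2 * n^2)"
    unfolding d using nz assms(1) by (simp add: divide_simps) algebra
  \<comment> \<open>The difference has only a simple pole at \<open>n = -1\<close>, matching the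
    single factor \<open>n + 1\<close> in \<open>c\<close>. In the term with \<open>k1\<close> the
    second factor \<open>n + 1\<close> is supplied by \<open>mu n\<close>.\<close>
  have k0: "(n^4 - 2 * n^3 - 2 * n - 1) / ((n - 1)^3 * (n + 1)^2 * n^2)
       - (n^2 - 3 * n - 2) / (n * (n^2 - 1)^2)
      = (2 * n^2 - 3 * n - 1) / ((n - 1)^3 * (n + 1) * n^2)"
    unfolding d using nz assms(1) by (simp add: divide_simps) algebra
  have L: "?L = mu'' n * y + 9 * (mu n * y) * (mu' n * y) + 15 * (mu n * y)^3
     + 3 * ((2 * n + 1) / (n * (n + 1))) * (mu' n * y + 3 * (mu n * y)^2)
     + (4 * n^4 - 6 * n^3 - n^2 + 6 * n + 1) / ((n - 1)^2 * (n + 1)^2 * n^2) * (mu n * y)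
     + (2 * n^2 - 3 * n - 1) / ((n - 1)^3 * (n + 1) * n^2)"
    unfolding k1 k0[symmetric] by (simp add: power_mult_distrib power2_eq_square)
  have terms: "c * (mu'' n * y) = (- 12 * n - 36) * w * n^2 * (n - 1)^2 * (n + 1)"
    "c * (9 * (mu n * y) * (mu' n * y)) = - 18 * (n + 1)^2 * (4 * n + 8) * w^2 * n^2 * (n - 1)^2"
    "c * (15 * (mu n * y)^3) = - 120 * (n + 1)^4 * w^3 * n^2 * (n - 1)^2"
    "c * (3 * ((2 * n + 1) / (n * (n + 1))) * (mu' n * y + 3 * (mu n * y)^2))
      = 3 * (2 * n + 1) * n * (n - 1)^3 * ((4 * n + 8) * w + 12 * (n + 1)^2 * w^2)"
    "c * ((4 * n^4 - 6 * n^3 - n^2 + 6 * n + 1) / ((n - 1)^2 * (n + 1)^2 * n^2) * (mu n * y))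
      = - 2 * (4 * n^4 - 6 * n^3 - n^2 + 6 * n + 1) * (n - 1)^2 * w"
    "c * ((2 * n^2 - 3 * n - 1) / ((n - 1)^3 * (n + 1) * n^2)) = (2 * n^2 - 3 * n - 1) * (n - 1)^2"
    unfolding scaled c' using nz assms(1)
    by (simp_all add: divide_simps power_mult_distrib) algebra+
  have "c * ?L = (- 12 * n - 36) * w * n^2 * (n - 1)^2 * (n + 1)
     + - 18 * (n + 1)^2 * (4 * n + 8) * w^2 * n^2 * (n - 1)^2
     + - 120 * (n + 1)^4 * w^3 * n^2 * (n - 1)^2
     + 3 * (2 * n + 1) * n * (n - 1)^3 * ((4 * n + 8) * w + 12 * (n + 1)^2 * w^2)
     + - 2 * (4 * n^4 - 6 * n^3 - n^2 + 6 * n + 1) * (n - 1)^2 * w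
     + (2 * n^2 - 3 * n - 1) * (n - 1)^2"
    by (simp only: L distrib_left[of c] terms)
  also have "\<dots> = (2 * n^2 - 3 * n - 1) * (n - 1)^2
      * (1 + 2 * ((n^2 + 6 * n + 1) * w) + 3 * (4 * n * (n + 1)^2 * w^2))
     - 6 * n * (n - 1)^2 * (n + 1)^2 * w
      * (3 + 4 * ((n^2 + 6 * n + 1) * w) + 5 * (4 * n * (n + 1)^2 * w^2))"
    by algebra
  also have "\<dots> = a * (1 + 2 * ((2 * h - 1) * y) + 3 * (h * (h - 1) * y^2))
      + (a * h + b) * y * (3 + 4 * ((2 * h - 1) * y) + 5 * (h * (h - 1) * y^2))"
  proof -
    have a: "a = (2 * n^2 - 3 * n - 1) * (n - 1)^2"
      unfolding a_def by algebra
    \<comment> \<open>Up to the factor \<open>(n - 1)^2\<close> this is the value of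
      \<open>a * t + b\<close> at the branch point \<open>t = tau n\<close>.\<close>
    have B: "a * (n + 1)^2 + b * (n - 1)^2 = - 6 * n * (n - 1)^2 * (n + 1)^2"
      unfolding a_def b_def by algebra
    show ?thesis
      unfolding scaled B unfolding a by simp
  qed
  also have "\<dots> = - 2 * (- a / 2 - (a * (2 * h - 1) + 3 / 2 * (a * h + b)) * y
        - (3 / 2 * a * (h * (h - 1)) + 2 * (a * h + b) * (2 * h - 1)) * y^2
        - 5 / 2 * (a * h + b) * (h * (h - 1)) * y^3)"
    by (simp add: divide_simps) algebra
  also have "\<dots> = c * ?R"
    unfolding c_def[symmetric] using c by simp
  finally show ?thesis
    unfolding mult_cancel_left using c by simp
qed

section \<open>Parameter derivatives of the branch point \<open>tau\<close>\<close>

lemma DERIV_tau: "n \<noteq> 1 \<Longrightarrow> (tau has_field_derivative 2 * mu n) (at n)"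
proof -
  assume "n \<noteq> 1"
  then have nz: "n - 1 \<noteq> 0"
    by simp
  have "((\<lambda>n. ((n + 1) / (n - 1))^2) has_field_derivative 2 * mu n) (at n)"
    by (rule DERIV_cong, (rule DERIV_const DERIV_ident DERIV_power DERIV_divide DERIV_add DERIV_diff nz)+)
      (use nz in \<open>simp add: mu_def divide_simps, algebra\<close>)
  then show ?thesis
    by (simp add: tau_def[abs_def])
qed

lemma DERIV_mu: "n \<noteq> 1 \<Longrightarrow> (mu has_field_derivative mu' n) (at n)"
proof -
  assume "n \<noteq> 1"
  then have nz: "n - 1 \<noteq> 0" "(n - 1)^3 \<noteq> 0"
    by simp_all
  show ?thesis
    unfolding mu_def[abs_def]
    by (rule DERIV_cong, (rule DERIV_const DERIV_ident DERIV_power DERIV_divide DERIV_mult DERIV_add DERIV_diff nz)+)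
      (use nz in \<open>simp add: mu'_def divide_simps, algebra\<close>)
qed

lemma DERIV_mu': "n \<noteq> 1 \<Longrightarrow> (mu' has_field_derivative mu'' n) (at n)"
proof -
  assume "n \<noteq> 1"
  then have nz: "n - 1 \<noteq> 0" "(n - 1)^4 \<noteq> 0"
    by simp_all
  show ?thesis
    unfolding mu'_def[abs_def]
    by (rule DERIV_cong, (rule DERIV_const DERIV_ident DERIV_power DERIV_divide DERIV_mult DERIV_add DERIV_diff nz)+)
      (use nz in \<open>simp add: mu''_def divide_simps, algebra\<close>)
qed

section \<open>Derivatives of forms\<close>

text \<open>The next derivative depends on nearby parameters, so the formula for the previous one
  has to hold on a whole open set \<open>N\<close>.\<close>

lemma d_nu2_power_Suc:
  assumes "open N" "n \<in> N"
    and eq: "\<And>n. n \<in> N \<Longrightarrow> (d_nu2 ^^ k) \<alpha> n p u v = G n"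
    and "(G has_field_derivative D) (at n)"
  shows "(d_nu2 ^^ Suc k) \<alpha> n p u v = D"
proof -
  have "((\<lambda>n. (d_nu2 ^^ k) \<alpha> n p u v) has_field_derivative D) (at n)"
    using assms(4,1,2) by (rule has_field_derivative_transform_within_open) (simp add: eq)
  then show ?thesis
    by (simp add: d_nu2_def DERIV_imp_deriv)
qed

text \<open>\<open>F k\<close> and \<open>G k\<close> serve as the k-th derivatives of the two
  factors of \<open>omega\<close>, and \<open>c\<close> as the value of \<open>ds\<close> wedge
  \<open>dt\<close> on the two vectors.\<close>

lemma d_nu2_product:
  fixes F G :: "nat \<Rightarrow> complex \<Rightarrow> complex"
  assumes N: "open N" "n \<in> N"
    and eq: "\<And>n. n \<in> N \<Longrightarrow> \<alpha> n p u v = F 0 n * G 0 n * c"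
    and F: "\<And>k n. k < 3 \<Longrightarrow> n \<in> N \<Longrightarrow> (F k has_field_derivative F (Suc k) n) (at n)"
    and G: "\<And>k n. k < 3 \<Longrightarrow> n \<in> N \<Longrightarrow> (G k has_field_derivative G (Suc k) n) (at n)"
  shows "d_nu2 \<alpha> n p u v = (F 1 n * G 0 n + F 0 n * G 1 n) * c"
    and "(d_nu2 ^^ 2) \<alpha> n p u v = (F 2 n * G 0 n + 2 * F 1 n * G 1 n + F 0 n * G 2 n) * c"
    and "(d_nu2 ^^ 3) \<alpha> n p u v
      = (F 3 n * G 0 n + 3 * F 2 n * G 1 n + 3 * F 1 n * G 2 n + F 0 n * G 3 n) * c"
proof -
  have F': "n \<in> N \<Longrightarrow> (F 0 has_field_derivative F 1 n) (at n)"
      "n \<in> N \<Longrightarrow> (F 1 has_field_derivative F 2 n) (at n)"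
      "n \<in> N \<Longrightarrow> (F 2 has_field_derivative F 3 n) (at n)" for n
    using F[of 0 n] F[of 1 n] F[of 2 n] by (simp_all add: eval_nat_numeral)
  have G': "n \<in> N \<Longrightarrow> (G 0 has_field_derivative G 1 n) (at n)"
      "n \<in> N \<Longrightarrow> (G 1 has_field_derivative G 2 n) (at n)"
      "n \<in> N \<Longrightarrow> (G 2 has_field_derivative G 3 n) (at n)" for n
    using G[of 0 n] G[of 1 n] G[of 2 n] by (simp_all add: eval_nat_numeral)
  have 1: "(d_nu2 ^^ Suc 0) \<alpha> n p u v = (F 1 n * G 0 n + F 0 n * G 1 n) * c" if "n \<in> N" for n
  proof (rule d_nu2_power_Suc[OF N(1) that])
    show "(d_nu2 ^^ 0) \<alpha> n p u v = F 0 n * G 0 n * c" if "n \<in> N" for n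
      using eq that by simp
    show "((\<lambda>n. F 0 n * G 0 n * c) has_field_derivative (F 1 n * G 0 n + F 0 n * G 1 n) * c) (at n)"
      by (rule DERIV_cong,
          (rule F'[OF that] G'[OF that] DERIV_const DERIV_mult)+) (simp add: algebra_simps)
  qed
  have 2: "(d_nu2 ^^ Suc (Suc 0)) \<alpha> n p u v
      = (F 2 n * G 0 n + 2 * F 1 n * G 1 n + F 0 n * G 2 n) * c" if "n \<in> N" for n
  proof (rule d_nu2_power_Suc[OF N(1) that 1])
    show "((\<lambda>n. (F 1 n * G 0 n + F 0 n * G 1 n) * c) has_field_derivative
        (F 2 n * G 0 n + 2 * F 1 n * G 1 n + F 0 n * G 2 n) * c) (at n)"
      by (rule DERIV_cong, (rule F'[OF that] G'[OF that] DERIV_const DERIV_mult DERIV_add)+)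
        (simp add: algebra_simps)
  qed
  have 3: "(d_nu2 ^^ Suc (Suc (Suc 0))) \<alpha> n p u v
      = (F 3 n * G 0 n + 3 * F 2 n * G 1 n + 3 * F 1 n * G 2 n + F 0 n * G 3 n) * c"
  proof (rule d_nu2_power_Suc[OF N 2])
    show "((\<lambda>n. (F 2 n * G 0 n + 2 * F 1 n * G 1 n + F 0 n * G 2 n) * c) has_field_derivative
      (F 3 n * G 0 n + 3 * F 2 n * G 1 n + 3 * F 1 n * G 2 n + F 0 n * G 3 n) * c) (at n)"
      by (rule DERIV_cong, (rule F'[OF N(2)] G'[OF N(2)] DERIV_const DERIV_mult DERIV_add)+)
        (simp add: algebra_simps)
  qed
  show "d_nu2 \<alpha> n p u v = (F 1 n * G 0 n + F 0 n * G 1 n) * c"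
    using 1[OF N(2)] by simp
  show "(d_nu2 ^^ 2) \<alpha> n p u v = (F 2 n * G 0 n + 2 * F 1 n * G 1 n + F 0 n * G 2 n) * c"
    using 2[OF N(2)] by (simp add: numeral_2_eq_2)
  show "(d_nu2 ^^ 3) \<alpha> n p u v
      = (F 3 n * G 0 n + 3 * F 2 n * G 1 n + 3 * F 1 n * G 2 n + F 0 n * G 3 n) * c"
    using 3 by (simp add: numeral_3_eq_3)
qed

lemma has_derivative_separated:
  fixes f g :: "complex \<Rightarrow> complex"
  assumes "(f has_field_derivative f') (at a)" "(g has_field_derivative g') (at b)"
  shows "((\<lambda>q. f (fst q) * g (snd q)) has_derivative
    (\<lambda>w. f a * (g' * snd w) + f' * fst w * g b)) (at (a, b))"
proof -
  have "((\<lambda>q. f (fst q)) has_derivative (\<lambda>w. f' * fst w)) (at (a, b))"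
    using has_derivative_compose[OF has_derivative_fst[OF has_derivative_ident],
        of f "(*) f'" "(a, b)" UNIV] assms(1)
    by (simp add: has_field_derivative_def)
  moreover have "((\<lambda>q. g (snd q)) has_derivative (\<lambda>w. g' * snd w)) (at (a, b))"
    using has_derivative_compose[OF has_derivative_snd[OF has_derivative_ident],
        of g "(*) g'" "(a, b)" UNIV] assms(2)
    by (simp add: has_field_derivative_def)
  ultimately show ?thesis
    using has_derivative_mult by fastforce
qed

text \<open>Antisymmetry leaves the s-derivatives of the \<open>dt\<close> coefficients and, with a
  minus sign, the t-derivatives of the \<open>ds\<close> coefficients.\<close>

lemma d_rel_separated:
  fixes f1 f2 f3 f4 g1 g2 g3 g4 :: "complex \<Rightarrow> complex"
  assumes S: "open S" "(a, b) \<in> S"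
    and eq: "\<And>s t w. (s, t) \<in> S \<Longrightarrow>
      \<beta> (s, t) w = (f1 s * g1 t + f2 s * g2 t) * snd w + (f3 s * g3 t + f4 s * g4 t) * fst w"
    and f: "(f1 has_field_derivative f1') (at a)" "(f2 has_field_derivative f2') (at a)"
      "(f3 has_field_derivative f3') (at a)" "(f4 has_field_derivative f4') (at a)"
    and g: "(g1 has_field_derivative g1') (at b)" "(g2 has_field_derivative g2') (at b)"
      "(g3 has_field_derivative g3') (at b)" "(g4 has_field_derivative g4') (at b)"
  shows "d_rel \<beta> (a, b) u v
    = (f1' * g1 b + f2' * g2 b - f3 a * g3' - f4 a * g4') * (fst u * snd v - fst v * snd u)"
proof -
  define D where "D w x =
     ((f1 a * (g1' * snd x) + f1' * fst x * g1 b) + (f2 a * (g2' * snd x) + f2' * fst x * g2 b)) * snd w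
   + ((f3 a * (g3' * snd x) + f3' * fst x * g3 b) + (f4 a * (g4' * snd x) + f4' * fst x * g4 b)) * fst w"
    for w x :: "complex \<times> complex"
  have "frechet_derivative (\<lambda>q. \<beta> q w) (at (a, b)) = D w" for w
  proof -
    have "((\<lambda>q. (f1 (fst q) * g1 (snd q) + f2 (fst q) * g2 (snd q)) * snd w
        + (f3 (fst q) * g3 (snd q) + f4 (fst q) * g4 (snd q)) * fst w) has_derivative D w) (at (a, b))"
      unfolding D_def[abs_def]
      by (intro has_derivative_add has_derivative_mult_left has_derivative_separated f g)
    then have "((\<lambda>q. \<beta> q w) has_derivative D w) (at (a, b))"
      by (rule has_derivative_transform_within_open[OF _ S]) (auto simp: eq)
    then show ?thesis
      by (rule frechet_derivative_at[symmetric])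
  qed
  then show ?thesis
    by (simp add: d_rel_def D_def algebra_simps)
qed

section \<open>The two curves\<close>

lemma legendre_branch_s: "sqrt_branch_on U cubic_s rs \<Longrightarrow>
    legendre_branch U (\<lambda>n. n^2) (\<lambda>n. n) (\<lambda>_. 1) (\<lambda>_. 0) UNIV rs"
  by unfold_locales (auto simp: cubic_s_def[abs_def] intro!: derivative_eq_intros)

lemma legendre_branch_t: "sqrt_branch_on V cubic_t rt \<Longrightarrow>
    legendre_branch V tau mu mu' mu'' (- {1}) rt"
  by unfold_locales (auto simp: cubic_t_def[abs_def] DERIV_tau DERIV_mu DERIV_mu')

theorem lemma4p1:
  fixes rs rt :: "complex \<Rightarrow> complex \<Rightarrow> complex"
    and U V :: "(complex \<times> complex) set"
    and \<nu> s t :: complex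
    and u v :: "complex \<times> complex"
  assumes "sqrt_branch_on U cubic_s rs"
    and "sqrt_branch_on V cubic_t rt"
    and "\<nu> \<notin> {0, 1, -1}"
    and "(\<nu>, s) \<in> U" and "s \<notin> {0, 1, \<nu>^2}"
    and "(\<nu>, t) \<in> V" and "t \<notin> {0, 1, tau \<nu>}"
  shows "(d_nu2 ^^ 3) (omega rs rt) \<nu> (s, t) u v
       + 3 * ((2 * \<nu> + 1) / (\<nu> * (\<nu> + 1))) * (d_nu2 ^^ 2) (omega rs rt) \<nu> (s, t) u v
       + (7 * \<nu>^4 - 6 * \<nu>^3 - 4 * \<nu>^2 + 6 * \<nu> + 1) / ((\<nu> - 1)^2 * (\<nu> + 1)^2 * \<nu>^2)
           * d_nu2 (omega rs rt) \<nu> (s, t) u v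
       + (\<nu>^4 - 2 * \<nu>^3 - 2 * \<nu> - 1) / ((\<nu> - 1)^3 * (\<nu> + 1)^2 * \<nu>^2)
           * omega rs rt \<nu> (s, t) u v
       = d_rel (beta rs rt \<nu>) (s, t) u v"
proof -
  interpret S: legendre_branch U "\<lambda>n. n^2" "\<lambda>n. n" "\<lambda>_. 1" "\<lambda>_. 0" UNIV rs
    using assms(1) by (rule legendre_branch_s)
  interpret T: legendre_branch V tau mu mu' mu'' "- {1}" rt
    using assms(2) by (rule legendre_branch_t)
  have nu: "\<nu> \<noteq> 0" "\<nu> \<noteq> 1" "\<nu> \<noteq> -1"
    using assms(3) by auto
  have S: "\<nu> \<in> S.pdom s" "s \<in> S.cdom \<nu>" and T: "\<nu> \<in> T.pdom t" "t \<in> T.cdom \<nu>"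
    using assms by (auto simp: S.pdom_def S.cdom_def T.pdom_def T.cdom_def)
  define D where "D = fst u * snd v - fst v * snd u"

  define F where "F k = (\<lambda>n. [1, S.L1 n s, S.L2 n s, S.L3 n s] ! k * S.W n s)" for k
  define G where "G k = (\<lambda>n. [1, T.L1 n t, T.L2 n t, T.L3 n t] ! k * T.W n t)" for k
  have FG: "F 0 = (\<lambda>n. S.W n s)" "F 1 = (\<lambda>n. S.L1 n s * S.W n s)"
      "F 2 = (\<lambda>n. S.L2 n s * S.W n s)" "F 3 = (\<lambda>n. S.L3 n s * S.W n s)"
      "G 0 = (\<lambda>n. T.W n t)" "G 1 = (\<lambda>n. T.L1 n t * T.W n t)"
      "G 2 = (\<lambda>n. T.L2 n t * T.W n t)" "G 3 = (\<lambda>n. T.L3 n t * T.W n t)"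
    by (simp_all add: F_def G_def)
  have F: "(F k has_field_derivative F (Suc k) n) (at n)" if "k < 3" "n \<in> S.pdom s \<inter> T.pdom t" for k n
  proof -
    have "k = 0 \<or> k = 1 \<or> k = 2"
      using that by auto
    then show ?thesis
      using that S.DERIV_W[of n s] S.DERIV_W1[of n s] S.DERIV_W2[of n s]
      by (auto simp: F_def)
  qed
  have G: "(G k has_field_derivative G (Suc k) n) (at n)" if "k < 3" "n \<in> S.pdom s \<inter> T.pdom t" for k n
  proof -
    have "k = 0 \<or> k = 1 \<or> k = 2"
      using that by auto
    then show ?thesis
      using that T.DERIV_W[of n t] T.DERIV_W1[of n t] T.DERIV_W2[of n t]
      by (auto simp: G_def)
  qed
  have om: "omega rs rt n (s, t) u v = F 0 n * G 0 n * D" for n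
    by (simp add: omega_def wedge_def omega_s_def omega_t_def ds_def dt_def FG S.W_def T.W_def
        D_def algebra_simps)
  have N: "open (S.pdom s \<inter> T.pdom t)" "\<nu> \<in> S.pdom s \<inter> T.pdom t"
    using S T S.open_pdom T.open_pdom by auto
  have omega_derivs:
      "(d_nu2 ^^ 3) (omega rs rt) \<nu> (s, t) u v
        = (F 3 \<nu> * G 0 \<nu> + 3 * F 2 \<nu> * G 1 \<nu> + 3 * F 1 \<nu> * G 2 \<nu> + F 0 \<nu> * G 3 \<nu>) * D"
      "(d_nu2 ^^ 2) (omega rs rt) \<nu> (s, t) u v
        = (F 2 \<nu> * G 0 \<nu> + 2 * F 1 \<nu> * G 1 \<nu> + F 0 \<nu> * G 2 \<nu>) * D"
      "d_nu2 (omega rs rt) \<nu> (s, t) u v = (F 1 \<nu> * G 0 \<nu> + F 0 \<nu> * G 1 \<nu>) * D"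
    by (rule d_nu2_product[OF N], (rule om F G; assumption)+)+

  define as bs where "as = \<nu>^2 - 3 * \<nu> - 2" and "bs = 2 * \<nu>^4 + 3 * \<nu>^3 - \<nu>^2"
  define at' bt where "at' = 2 * \<nu>^4 - 7 * \<nu>^3 + 7 * \<nu>^2 - \<nu> - 1"
    and "bt = - 2 * \<nu>^4 - 7 * \<nu>^3 - 7 * \<nu>^2 - \<nu> + 1"
  \<comment> \<open>The coefficients in
    \<open>beta = P omega_t + Q omega_t' + R omega_s + Z omega_s'\<close>: \<open>P\<close> and
    \<open>Q\<close> are functions of s, \<open>R\<close> and \<open>Z\<close> of t.\<close>
  define P where "P e = - 2 / (\<nu> * (\<nu>^2 - 1)^2)
      * (e * (e - 1) * (as * e + bs) / ((e - \<nu>^2)^2 * rs \<nu> e))" for e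
  define Q where "Q e = 6 / (1 - \<nu>^2) * (rs \<nu> e / (e - \<nu>^2)^2)" for e
  define R where "R e = 2 / (\<nu>^2 * (\<nu> - 1)^4 * (\<nu>^2 - 1))
      * (e * (e - 1) * (at' * e + bt) / ((e - tau \<nu>)^2 * rt \<nu> e))" for e
  define Z where "Z e = 6 / (\<nu> * (\<nu> - 1)^2) * (rt \<nu> e / (e - tau \<nu>)^2)" for e

  define A where "A = S.W \<nu> s"
  define B where "B = T.W \<nu> t"
  define l1 l2 l3 where "l1 = S.L1 \<nu> s" and "l2 = S.L2 \<nu> s" and "l3 = S.L3 \<nu> s"
  define m1 m2 m3 where "m1 = T.L1 \<nu> t" and "m2 = T.L2 \<nu> t" and "m3 = T.L3 \<nu> t"
  define c2 where "c2 = (2 * \<nu> + 1) / (\<nu> * (\<nu> + 1))"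
  define c1 where "c1 = (7 * \<nu>^4 - 6 * \<nu>^3 - 4 * \<nu>^2 + 6 * \<nu> + 1) / ((\<nu> - 1)^2 * (\<nu> + 1)^2 * \<nu>^2)"
  define c0 where "c0 = (\<nu>^4 - 2 * \<nu>^3 - 2 * \<nu> - 1) / ((\<nu> - 1)^3 * (\<nu> + 1)^2 * \<nu>^2)"
  \<comment> \<open>\<open>k1\<close> is forced by the coefficient of \<open>y\<close> in
    \<open>mixed_identity_s\<close>. The constants \<open>-k2\<close>, \<open>-k3\<close>,
    \<open>k4\<close> are the limits at infinity of the derivatives of \<open>Q\<close>,
    \<open>Z\<close>, \<open>P\<close> divided by \<open>W\<close>.\<close>
  define k1 where "k1 = (3 - 9 * \<nu>^2) / (\<nu> * (1 - \<nu>^2))"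
  define k2 where "k2 = 3 / (1 - \<nu>^2)"
  define k3 where "k3 = 3 / (\<nu> * (\<nu> - 1)^2)"
  define k4 where "k4 = (\<nu>^2 - 3 * \<nu> - 2) / (\<nu> * (\<nu>^2 - 1)^2)"
  note local_defs = l1_def l2_def l3_def m1_def m2_def m3_def c2_def c1_def c0_def k1_def k2_def
    k3_def k4_def A_def B_def as_def bs_def at'_def bt_def
  note Ls = S.L1_def S.L2_def S.L3_def T.L1_def T.L2_def T.L3_def
  have "(P has_field_derivative (l3 + 3 * c2 * l2 + (c1 - k3) * l1 + k4) * A) (at s)"
    unfolding P_def[abs_def]
    by (rule DERIV_cong[OF DERIV_cmult[OF S.DERIV_cubic_W[OF S(2)]]])
      (use pure_identity_s[OF nu, of "S.y \<nu> s"] in \<open>simp add: local_defs Ls\<close>)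
  moreover have "(Q has_field_derivative (3 * l2 + k1 * l1 - k2) * A) (at s)"
    unfolding Q_def[abs_def]
    by (rule DERIV_cong[OF DERIV_cmult[OF S.DERIV_r_quotient[OF S(2)]]])
      (use mixed_identity_s[OF nu, of "S.y \<nu> s"] in \<open>simp add: local_defs Ls\<close>)
  \<comment> \<open>The minus sign here and for \<open>Z\<close> compensates the one in d(f ds) = -
    f_t ds wedge dt.\<close>
  moreover have "(R has_field_derivative - (m3 + 3 * c2 * m2 + (c1 + k2) * m1 + c0 - k4) * B) (at t)"
    unfolding R_def[abs_def]
    by (rule DERIV_cong[OF DERIV_cmult[OF T.DERIV_cubic_W[OF T(2)]]])
      (use pure_identity_t[OF nu, of "T.y \<nu> t"] in \<open>simp add: local_defs Ls\<close>)
  moreover have "(Z has_field_derivative - (3 * m2 + (6 * c2 - k1) * m1 + k3) * B) (at t)"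
    unfolding Z_def[abs_def]
    by (rule DERIV_cong[OF DERIV_cmult[OF T.DERIV_r_quotient[OF T(2)]]])
      (use mixed_identity_t[OF nu, of "T.y \<nu> t"] in \<open>simp add: local_defs Ls\<close>)
  moreover
  \<comment> \<open>These derivatives ensure that the coefficients of \<open>beta\<close> are
    differentiable; their values cancel by antisymmetry.\<close>
  have L1W: "((\<lambda>e. S.L1 \<nu> e * S.W \<nu> e) has_field_derivative
        (\<nu> * - ((S.y \<nu> s)^2)) * S.W \<nu> s
          + - (1 / s + 1 / (s - 1) + S.y \<nu> s) / 2 * S.W \<nu> s * S.L1 \<nu> s) (at s)"
      "((\<lambda>e. T.L1 \<nu> e * T.W \<nu> e) has_field_derivative
        (mu \<nu> * - ((T.y \<nu> t)^2)) * T.W \<nu> t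
          + - (1 / t + 1 / (t - 1) + T.y \<nu> t) / 2 * T.W \<nu> t * T.L1 \<nu> t) (at t)"
    unfolding S.L1_def T.L1_def
    by (intro DERIV_mult DERIV_cmult S.DERIV_y_coord T.DERIV_y_coord S.DERIV_W_coord T.DERIV_W_coord S T)+
  moreover have "beta rs rt \<nu> (s', t') w = (P s' * T.W \<nu> t' + Q s' * (T.L1 \<nu> t' * T.W \<nu> t')) * snd w
      + (S.W \<nu> s' * R t' + (S.L1 \<nu> s' * S.W \<nu> s') * Z t') * fst w"
    if "(s', t') \<in> S.cdom \<nu> \<times> T.cdom \<nu>" for s' t' w
  proof -
    \<comment> \<open>The parameter derivatives inside \<open>beta\<close> are thus known at every
      point near (s, t), as its exterior derivative requires.\<close>
    have "\<nu> \<in> S.pdom s'" "\<nu> \<in> T.pdom t'"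
      using that nu by (auto simp: S.pdom_def S.cdom_def T.pdom_def T.cdom_def)
    then have "deriv (\<lambda>n. S.W n s' * fst w) \<nu> = S.L1 \<nu> s' * S.W \<nu> s' * fst w"
      "deriv (\<lambda>n. T.W n t' * snd w) \<nu> = T.L1 \<nu> t' * T.W \<nu> t' * snd w"
      by (auto intro!: DERIV_imp_deriv DERIV_cmult_right S.DERIV_W T.DERIV_W)
    then have d: "d_nu1 (omega_s rs) \<nu> (s', t') w = S.L1 \<nu> s' * S.W \<nu> s' * fst w"
      "d_nu1 (omega_t rt) \<nu> (s', t') w = T.L1 \<nu> t' * T.W \<nu> t' * snd w"
      by (simp_all add: d_nu1_def omega_s_def omega_t_def ds_def dt_def S.W_def T.W_def)
    have as: "2 * \<nu>^4 + 3 * \<nu>^3 - \<nu>^2 - 3 * \<nu> * s' + s' * \<nu>^2 - 2 * s' = as * s' + bs"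
      and at': "2 * t' * \<nu>^4 - 7 * t' * \<nu>^3 + 7 * t' * \<nu>^2 - t' * \<nu> - t'
          - 2 * \<nu>^4 - 7 * \<nu>^3 - 7 * \<nu>^2 - \<nu> + 1 = at' * t' + bt"
      unfolding as_def bs_def at'_def bt_def by algebra+
    have "beta rs rt \<nu> (s', t') w =
        P s' * (T.W \<nu> t' * snd w) + Q s' * (T.L1 \<nu> t' * T.W \<nu> t' * snd w)
        + R t' * (S.W \<nu> s' * fst w) + Z t' * (S.L1 \<nu> s' * S.W \<nu> s' * fst w)"
      unfolding beta_def P_def Q_def R_def Z_def prod.case d as at'
      by (simp add: omega_s_def omega_t_def ds_def dt_def S.W_def T.W_def mult_ac)
        (simp add: algebra_simps add_divide_distrib diff_divide_distrib)
    then show ?thesis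
      by (simp add: algebra_simps)
  qed
  ultimately have "d_rel (beta rs rt \<nu>) (s, t) u v
      = ((l3 + 3 * c2 * l2 + (c1 - k3) * l1 + k4) * A * B + (3 * l2 + k1 * l1 - k2) * A * (m1 * B)
         - A * (- (m3 + 3 * c2 * m2 + (c1 + k2) * m1 + c0 - k4) * B)
         - l1 * A * (- (3 * m2 + (6 * c2 - k1) * m1 + k3) * B)) * D"
    unfolding D_def A_def B_def l1_def m1_def
    using S T S.DERIV_W_coord[OF S(2)] T.DERIV_W_coord[OF T(2)]
    by (intro d_rel_separated[OF open_Times[OF S.open_cdom T.open_cdom]]) auto
  \<comment> \<open>Each of \<open>k1\<close> to \<open>k4\<close> occurs twice with opposite signs
    and drops out, which leaves the Leibniz expansion.\<close>
  also have "\<dots> = (l3 * A * B + 3 * (l2 * A) * (m1 * B) + 3 * (l1 * A) * (m2 * B) + A * (m3 * B)) * D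
      + 3 * c2 * ((l2 * A * B + 2 * (l1 * A) * (m1 * B) + A * (m2 * B)) * D)
      + c1 * ((l1 * A * B + A * (m1 * B)) * D) + c0 * (A * B * D)"
    by algebra
  also have "\<dots> = (F 3 \<nu> * G 0 \<nu> + 3 * F 2 \<nu> * G 1 \<nu> + 3 * F 1 \<nu> * G 2 \<nu> + F 0 \<nu> * G 3 \<nu>) * D
      + 3 * c2 * ((F 2 \<nu> * G 0 \<nu> + 2 * F 1 \<nu> * G 1 \<nu> + F 0 \<nu> * G 2 \<nu>) * D)
      + c1 * ((F 1 \<nu> * G 0 \<nu> + F 0 \<nu> * G 1 \<nu>) * D) + c0 * (F 0 \<nu> * G 0 \<nu> * D)"
    unfolding FG by (simp only: local_defs)
  finally show ?thesis
    unfolding omega_derivs om c0_def c1_def c2_def by (rule sym)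
qed

end
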